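(* Fix $\theta\in\Omega$ and assume that the weighted Fermat–Torricelli point $a_{\mathrm{wFT}}$ does not coincide with $x^{(j)}$ for $j=1,2,3$. Then the triple junction $a$ coincides with $a_{\mathrm{wFT}}$ if and only if $$1-\cos\psi^{(i)}=\frac{(\sigma(\theta_i)+\sigma(\theta_{i+1}))^2-\sigma(\theta_{i+2})^2}{2\,\sigma(\theta_i)\,\sigma(\theta_{i+1})}\qquad\text{for } i=1,2,3.$$
   Context: Indices are cyclic modulo 3. $\theta=(\theta_1,\theta_2,\theta_3)\in\Omega=\{\theta\in(-\frac{\pi}{4},\frac{\pi}{4})^3:\theta_1+\theta_2+\theta_3=0\}$ are the misorientations. $\sigma:\mathbb{R}\to\mathbb{R}$ is a $C^1$ function (the surface tension / grain boundary energy density), with $\sigma(\theta_j)>0$ for $j=1,2,3$. $x^{(1)},x^{(2)},x^{(3)}\in\mathbb{R}^2$ are fixed points, $\Omega_{\mathrm{TJ}}\subset\mathbb{R}^2$ is a bounded domain (open connected set), and $E(\theta,a)=\sum_{j=1}^3\sigma(\theta_j)|a-x^{(j)}|$. The weighted Fermat–Torricelli point $a_{\mathrm{wFT}}\in\Omega_{\mathrm{TJ}}$ is the (unique) minimizer of $a\mapsto E(\theta,a)$ over $\Omega_{\mathrm{TJ}}$, which is taken to exist. The triple junction is a point $a\in\Omega_{\mathrm{TJ}}$ with $a\ne x^{(j)}$ for all $j$, and $\psi^{(i)}$ is the angle at $a$ formed by the vectors $a-x^{(i)}$ and $a-x^{(i+1)}$, i.e. $\cos\psi^{(i)}=\frac{(a-x^{(i)})\cdot(a-x^{(i+1)})}{|a-x^{(i)}||a-x^{(i+1)}|}$.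 *)

theory Defs
  imports "HOL-Analysis.Analysis"
begin

text \<open>
  Indices range over the numeral type \<open>3\<close>, whose arithmetic is modulo 3; its elements
  are \<open>1\<close>, \<open>2\<close> and \<open>3 = 0\<close>, so \<open>i + 1\<close> and \<open>i + 2\<close> are the cyclic successors of \<open>i\<close>.
\<close>

definition misorientations :: "(real ^ 3) set" where
  "misorientations =
     {\<theta>. (\<forall>j. \<theta> $ j \<in> {- (pi / 4) <..< pi / 4}) \<and> (\<Sum>j\<in>UNIV. \<theta> $ j) = 0}"

definition gb_energy ::
    "(real \<Rightarrow> real) \<Rightarrow> (3 \<Rightarrow> real ^ 2) \<Rightarrow> real ^ 3 \<Rightarrow> real ^ 2 \<Rightarrow> real" where
  "gb_energy \<sigma> x \<theta> a = (\<Sum>j\<in>UNIV. \<sigma> (\<theta> $ j) * norm (a - x j))"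

text \<open>
  Uniqueness of the minimizer is part of the notion: if the \<open>x j\<close> are collinear, there
  can be a whole segment of minimizers.
\<close>

definition is_wFT_point ::
    "(real ^ 2) set \<Rightarrow> (real \<Rightarrow> real) \<Rightarrow> (3 \<Rightarrow> real ^ 2) \<Rightarrow> real ^ 3 \<Rightarrow> real ^ 2 \<Rightarrow> bool" where
  "is_wFT_point \<Omega>TJ \<sigma> x \<theta> w \<longleftrightarrow>
     is_arg_min (gb_energy \<sigma> x \<theta>) (\<lambda>b. b \<in> \<Omega>TJ) w \<and>
     (\<forall>b. is_arg_min (gb_energy \<sigma> x \<theta>) (\<lambda>c. c \<in> \<Omega>TJ) b \<longrightarrow> b = w)"

text \<open>Only meaningful for nonzero vectors.\<close>

definition vec_angle :: "real ^ 2 \<Rightarrow> real ^ 2 \<Rightarrow> real" where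
  "vec_angle u v = arccos ((u \<bullet> v) / (norm u * norm v))"

definition junction_angle :: "(3 \<Rightarrow> real ^ 2) \<Rightarrow> real ^ 2 \<Rightarrow> 3 \<Rightarrow> real" where
  "junction_angle x a i = vec_angle (a - x i) (a - x (i + 1))"

end

theory Submission imports Defs
begin

text \<open>
  With unit vectors \<open>e\<^sub>j = sgn (a - x\<^sub>j)\<close> and weights \<open>w\<^sub>j = \<sigma>(\<theta>\<^sub>j)\<close>, the energy is convex with gradient
  \<open>\<Sum> w\<^sub>j e\<^sub>j\<close> at any \<open>a\<close> other than the \<open>x\<^sub>j\<close>, so \<open>a\<close> minimizes it iff this vector vanishes. The \<open>i\<close>-th
  angle condition says \<open>|w\<^sub>i e\<^sub>i + w\<^sub>i\<^sub>+\<^sub>1 e\<^sub>i\<^sub>+\<^sub>1|\<^sup>2 = w\<^sub>i\<^sub>+\<^sub>2\<^sup>2\<close>, which follows from \<open>\<Sum> w\<^sub>j e\<^sub>j = 0\<close>; conversely the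
  three conditions add up to \<open>|\<Sum> w\<^sub>j e\<^sub>j|\<^sup>2 = 0\<close>.
\<close>

text \<open>Cauchy-Schwarz makes \<open>sgn (a - x j)\<close> a subgradient at \<open>a\<close> of
  the distance to \<open>x j\<close>; if \<open>a = x j\<close>, it is \<open>0\<close>, still a
  subgradient. In the weighted sum of these bounds the linear term in \<open>b - a\<close> cancels
  by \<open>balance\<close>.\<close>

lemma weighted_distance_sum_ge:
  fixes x :: "'i \<Rightarrow> 'a::real_inner"
  assumes nonneg: "\<And>j. j \<in> I \<Longrightarrow> 0 \<le> w j"
    and balance: "(\<Sum>j\<in>I. w j *\<^sub>R sgn (a - x j)) = 0"
  shows "(\<Sum>j\<in>I. w j * norm (a - x j)) \<le> (\<Sum>j\<in>I. w j * norm (b - x j))"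
proof -
  have summand: "w j * norm (a - x j) + (w j *\<^sub>R sgn (a - x j)) \<bullet> (b - a) \<le> w j * norm (b - x j)"
    if "j \<in> I" for j
  proof -
    have "sgn (a - x j) \<bullet> (a - x j) = norm (a - x j)"
      by (cases "a = x j") (simp_all add: sgn_div_norm dot_square_norm power2_eq_square)
    then have "norm (a - x j) + sgn (a - x j) \<bullet> (b - a) = sgn (a - x j) \<bullet> (b - x j)"
      by (simp add: inner_diff_right)
    also have "\<dots> \<le> norm (sgn (a - x j)) * norm (b - x j)"
      by (rule norm_cauchy_schwarz)
    also have "\<dots> \<le> norm (b - x j)"
      by (simp add: norm_sgn)
    finally have "w j * (norm (a - x j) + sgn (a - x j) \<bullet> (b - a)) \<le> w j * norm (b - x j)"
      using nonneg[OF that] by (rule mult_left_mono)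
    then show ?thesis
      by (simp add: distrib_left)
  qed
  have "(\<Sum>j\<in>I. w j * norm (a - x j)) =
      (\<Sum>j\<in>I. w j * norm (a - x j)) + (\<Sum>j\<in>I. w j *\<^sub>R sgn (a - x j)) \<bullet> (b - a)"
    by (simp only: balance inner_zero_left add_0_right)
  also have "\<dots> = (\<Sum>j\<in>I. w j * norm (a - x j) + (w j *\<^sub>R sgn (a - x j)) \<bullet> (b - a))"
    by (simp add: inner_sum_left sum.distrib)
  also have "\<dots> \<le> (\<Sum>j\<in>I. w j * norm (b - x j))"
    by (rule sum_mono) (rule summand)
  finally show ?thesis .
qed

text \<open>Fermat's rule: the distances are differentiable at \<open>a\<close> away from the
  \<open>x j\<close>, and openness of \<open>S\<close> makes \<open>a\<close> an interior
  minimum.\<close>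

lemma weighted_distance_sum_critical:
  fixes x :: "'i \<Rightarrow> 'a::real_inner"
  assumes "open S" "a \<in> S"
    and min: "\<And>b. b \<in> S \<Longrightarrow> (\<Sum>j\<in>I. w j * norm (a - x j)) \<le> (\<Sum>j\<in>I. w j * norm (b - x j))"
    and off: "\<And>j. j \<in> I \<Longrightarrow> a \<noteq> x j"
  shows "(\<Sum>j\<in>I. w j *\<^sub>R sgn (a - x j)) = 0"
proof -
  let ?g = "\<Sum>j\<in>I. w j *\<^sub>R sgn (a - x j)"
  have "((\<lambda>b. norm (b - x j)) has_derivative (\<lambda>h. h \<bullet> sgn (a - x j))) (at a)" if "j \<in> I" for j
  proof (rule has_derivative_compose[where g = norm])
    show "((\<lambda>b. b - x j) has_derivative (\<lambda>h. h)) (at a)"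
      by (auto intro!: derivative_eq_intros)
    show "(norm has_derivative (\<lambda>h. h \<bullet> sgn (a - x j))) (at (a - x j))"
      using off[OF that] by (intro has_derivative_norm) simp
  qed
  then have "((\<lambda>b. \<Sum>j\<in>I. w j * norm (b - x j)) has_derivative
      (\<lambda>h. \<Sum>j\<in>I. w j * (h \<bullet> sgn (a - x j)))) (at a)"
    by (auto intro!: derivative_eq_intros)
  then have "(\<lambda>h. \<Sum>j\<in>I. w j * (h \<bullet> sgn (a - x j))) = (\<lambda>h. 0)"
    using assms(1,2) min by (intro differential_zero_maxmin[of a S]) auto
  \<comment> \<open>The vanishing derivative is evaluated in the direction of the gradient
    \<open>?g\<close> itself, which gives the squared norm of \<open>?g\<close>.\<close>
  then have "(\<Sum>j\<in>I. w j * (?g \<bullet> sgn (a - x j))) = 0"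
    by meson
  then have "?g \<bullet> ?g = 0"
    by (simp add: inner_sum_right)
  then show ?thesis
    by simp
qed

lemma sum_3_cyclic:
  fixes f :: "3 \<Rightarrow> 'a::comm_monoid_add"
  shows "(\<Sum>j\<in>UNIV. f j) = f i + f (i + 1) + f (i + 2)"
proof -
  \<comment> \<open>The cases \<open>i = 2\<close> and \<open>i = 3\<close> produce the numerals 4
    and 5, to be matched with the indices 1, 2, 3 of \<open>sum_3\<close>.\<close>
  have mod_3: "(4::3) = 1" "(5::3) = 2"
    by simp_all
  show ?thesis
    using exhaust_3[of i] by (auto simp: sum_3 mod_3 ac_simps)
qed

lemma sum_3_eq_0_iff:
  fixes v :: "3 \<Rightarrow> 'a::real_inner"
  shows "(\<Sum>j\<in>UNIV. v j) = 0 \<longleftrightarrow> (\<forall>i. (norm (v i + v (i + 1)))\<^sup>2 = (norm (v (i + 2)))\<^sup>2)"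
proof
  assume sum0: "(\<Sum>j\<in>UNIV. v j) = 0"
  show "\<forall>i. (norm (v i + v (i + 1)))\<^sup>2 = (norm (v (i + 2)))\<^sup>2"
  proof
    fix i
    have "v i + v (i + 1) = - v (i + 2)"
      using sum0 sum_3_cyclic[of v i] by (simp add: eq_neg_iff_add_eq_0)
    then show "(norm (v i + v (i + 1)))\<^sup>2 = (norm (v (i + 2)))\<^sup>2"
      by simp
  qed
next
  assume pairs: "\<forall>i. (norm (v i + v (i + 1)))\<^sup>2 = (norm (v (i + 2)))\<^sup>2"
  have mod_3: "(3::3) = 0" "(4::3) = 1"
    by simp_all
  have "(norm (v 0 + v 1))\<^sup>2 = (norm (v 2))\<^sup>2" "(norm (v 1 + v 2))\<^sup>2 = (norm (v 0))\<^sup>2"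
    "(norm (v 2 + v 0))\<^sup>2 = (norm (v 1))\<^sup>2"
    using pairs[rule_format, of 0] pairs[rule_format, of 1] pairs[rule_format, of 2] by (simp_all add: mod_3)
  \<comment> \<open>After expansion, the three equations add up to: the squared norms plus twice the
    mixed inner products equal 0.\<close>
  then have "(v 0 + v 1 + v 2) \<bullet> (v 0 + v 1 + v 2) = 0"
    by (simp add: power2_norm_eq_inner inner_simps inner_commute)
  then show "(\<Sum>j\<in>UNIV. v j) = 0"
    using sum_3_cyclic[of v 0] by simp
qed

text \<open>Cauchy-Schwarz keeps the argument of \<open>arccos\<close> in [-1, 1], where
  \<open>cos\<close> inverts it. For a zero vector both sides are 0, since division by 0 yields
  0.\<close>

lemma cos_vec_angle: "cos (vec_angle u v) = sgn u \<bullet> sgn v"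
proof -
  have "\<bar>sgn u \<bullet> sgn v\<bar> \<le> norm (sgn u) * norm (sgn v)"
    by (rule Cauchy_Schwarz_ineq2)
  also have "\<dots> \<le> 1"
    by (simp add: norm_sgn)
  finally have "cos (arccos (sgn u \<bullet> sgn v)) = sgn u \<bullet> sgn v"
    by (rule cos_arccos_abs)
  then show ?thesis
    by (simp add: vec_angle_def sgn_div_norm field_simps)
qed

text \<open>Law of cosines: the squared norm is
  \<open>(p + q)\<^sup>2 - 2 * p * q * (1 - e \<bullet> f)\<close>, and \<open>2 * p * q\<close> is
  positive.\<close>

lemma angle_condition_iff:
  fixes p q r :: real
  assumes "norm e = 1" "norm f = 1" "p > 0" "q > 0"
  shows "1 - e \<bullet> f = ((p + q)\<^sup>2 - r\<^sup>2) / (2 * p * q) \<longleftrightarrow> (norm (p *\<^sub>R e + q *\<^sub>R f))\<^sup>2 = r\<^sup>2"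
proof -
  have "e \<bullet> e = 1" "f \<bullet> f = 1"
    using assms by (simp_all add: dot_square_norm)
  then have "(norm (p *\<^sub>R e + q *\<^sub>R f))\<^sup>2 = p\<^sup>2 + q\<^sup>2 + 2 * p * q * (e \<bullet> f)"
    unfolding power2_norm_eq_inner by (simp add: inner_simps inner_commute power2_eq_square)
  then show ?thesis
    using assms by (auto simp: field_simps power2_eq_square)
qed

theorem proposition4p7:
  fixes \<sigma> :: "real \<Rightarrow> real"
    and \<theta> :: "real ^ 3"
    and x :: "3 \<Rightarrow> real ^ 2"
    and \<Omega>TJ :: "(real ^ 2) set"
    and a a_wFT :: "real ^ 2"
  assumes "\<theta> \<in> misorientations"
    and "\<sigma> C1_differentiable_on UNIV"
    and "\<And>j. \<sigma> (\<theta> $ j) > 0"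
    and "open \<Omega>TJ" and "connected \<Omega>TJ" and "bounded \<Omega>TJ"
    and "is_wFT_point \<Omega>TJ \<sigma> x \<theta> a_wFT"
    and "\<And>j. a_wFT \<noteq> x j"
    and "a \<in> \<Omega>TJ"
    and "\<And>j. a \<noteq> x j"
  shows "a = a_wFT \<longleftrightarrow>
    (\<forall>i. 1 - cos (junction_angle x a i) =
       ((\<sigma> (\<theta> $ i) + \<sigma> (\<theta> $ (i + 1)))\<^sup>2 - (\<sigma> (\<theta> $ (i + 2)))\<^sup>2) /
       (2 * \<sigma> (\<theta> $ i) * \<sigma> (\<theta> $ (i + 1))))"
proof -
  define w where "w j = \<sigma> (\<theta> $ j)" for j
  have w_pos: "w j > 0" for j
    using assms(3) by (simp add: w_def)
  let ?E = "gb_energy \<sigma> x \<theta>"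
  have E_eq: "?E b = (\<Sum>j\<in>UNIV. w j * norm (b - x j))" for b
    by (simp add: gb_energy_def w_def)
  \<comment> \<open>The direction from right to left is the uniqueness of the minimizer.\<close>
  have "a = a_wFT \<longleftrightarrow> is_arg_min ?E (\<lambda>b. b \<in> \<Omega>TJ) a"
    using assms(7) by (auto simp: is_wFT_point_def)
  also have "\<dots> \<longleftrightarrow> (\<Sum>j\<in>UNIV. w j *\<^sub>R sgn (a - x j)) = 0"
  proof
    assume "is_arg_min ?E (\<lambda>b. b \<in> \<Omega>TJ) a"
    then have "?E a \<le> ?E b" if "b \<in> \<Omega>TJ" for b
      using that by (auto simp: is_arg_min_def not_less)
    then show "(\<Sum>j\<in>UNIV. w j *\<^sub>R sgn (a - x j)) = 0"
      using assms(4,9,10) unfolding E_eq by (intro weighted_distance_sum_critical) auto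
  next
    assume "(\<Sum>j\<in>UNIV. w j *\<^sub>R sgn (a - x j)) = 0"
    then have "?E a \<le> ?E b" for b
      unfolding E_eq using w_pos by (intro weighted_distance_sum_ge) (auto intro: less_imp_le)
    then show "is_arg_min ?E (\<lambda>b. b \<in> \<Omega>TJ) a"
      using assms(9) by (auto simp: is_arg_min_def not_less)
  qed
  \<comment> \<open>Here \<open>v j\<close> is \<open>w j *\<^sub>R sgn (a - x j)\<close>, of
    squared norm \<open>(w j)\<^sup>2\<close> because \<open>a\<close> differs from
    \<open>x j\<close>.\<close>
  also have "\<dots> \<longleftrightarrow> (\<forall>i. (norm (w i *\<^sub>R sgn (a - x i) + w (i + 1) *\<^sub>R sgn (a - x (i + 1))))\<^sup>2 = (w (i + 2))\<^sup>2)"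
    using assms(10) by (simp add: sum_3_eq_0_iff norm_sgn)
  also have "\<dots> \<longleftrightarrow> (\<forall>i. 1 - cos (junction_angle x a i) =
      ((w i + w (i + 1))\<^sup>2 - (w (i + 2))\<^sup>2) / (2 * w i * w (i + 1)))"
    using assms(10) w_pos
    by (simp add: junction_angle_def cos_vec_angle angle_condition_iff norm_sgn)
  finally show ?thesis
    by (simp add: w_def)
qed

end
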